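(* For every finite graph $G$, there is a finite commutative local ring $R$ with unity such that $G$ is isomorphic to an induced subgraph of the zero-divisor graph $\Gamma(R)$.
   Context: Graphs are finite simple undirected graphs. A local ring is a ring with a unique maximal ideal. For a finite commutative ring $R$ with unity, the zero-divisor graph $\Gamma(R)$ has as vertices the non-zero elements $a\in R$ for which there exists $b\neq 0$ in $R$ with $ab=0$; two distinct vertices $a,b$ are adjacent if and only if $ab=0$. *)

theory Defs
  imports "HOL-Algebra.Ideal"
    "Graph_Theory.Digraph_Component" "Graph_Theory.Digraph_Isomorphism"
begin

locale local_cring = cring +
  assumes unique_maximalideal: "\<exists>!M. maximalideal M R"

text \<open>
  Following \<^theory>\<open>Graph_Theory.Digraph\<close>, an undirected simple graph is a symmetric digraph without
  loops and parallel arcs; an edge \<open>{a, b}\<close> is the pair of arcs \<open>(a, b)\<close>, \<open>(b, a)\<close>.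
\<close>

definition zero_divisor_graph :: "('a, 'm) ring_scheme \<Rightarrow> ('a, 'a \<times> 'a) pre_digraph" where
  "zero_divisor_graph R =
    (let V = {a \<in> carrier R - {\<zero>\<^bsub>R\<^esub>}. \<exists>b \<in> carrier R. b \<noteq> \<zero>\<^bsub>R\<^esub> \<and> a \<otimes>\<^bsub>R\<^esub> b = \<zero>\<^bsub>R\<^esub>}
     in \<lparr> verts = V,
          arcs = {(a, b). a \<in> V \<and> b \<in> V \<and> a \<noteq> b \<and> a \<otimes>\<^bsub>R\<^esub> b = \<zero>\<^bsub>R\<^esub>},
          tail = fst, head = snd \<rparr>)"

lemma graph_zero_divisor_graph:
  assumes "cring R" and fin: "finite (carrier R)"
  shows "Digraph.graph (zero_divisor_graph R)"
proof -
  interpret cring R by fact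
  let ?G = "zero_divisor_graph R"
  have fv: "finite (verts ?G)"
    using fin by (simp add: zero_divisor_graph_def Let_def)
  have wf: "tail ?G e \<in> verts ?G \<and> head ?G e \<in> verts ?G \<and> tail ?G e \<noteq> head ?G e"
    if "e \<in> arcs ?G" for e
    using that by (cases e) (simp add: zero_divisor_graph_def Let_def)
  have swap: "(b, a) \<in> arcs ?G" if "(a, b) \<in> arcs ?G" for a b
  proof -
    have "a \<in> carrier R" "b \<in> carrier R"
      using that by (simp_all add: zero_divisor_graph_def Let_def)
    then show ?thesis
      using that m_comm[of a b] not_sym[of a b] by (simp add: zero_divisor_graph_def Let_def)
  qed
  have ends: "arc_to_ends ?G e = e" for e
    by (simp add: zero_divisor_graph_def Let_def arc_to_ends_def)
  have "arcs ?G \<subseteq> verts ?G \<times> verts ?G"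
    unfolding zero_divisor_graph_def Let_def by (simp add: subset_iff)
  then have fa: "finite (arcs ?G)"
    using fv finite_subset finite_cartesian_product by blast
  have sym: "symmetric ?G"
    using swap by (simp add: symmetric_def sym_def arcs_ends_def ends)
  show ?thesis
    by unfold_locales (use wf fv fa sym ends in simp_all)
qed

end

theory Submission
  imports Defs "HOL-Algebra.Weak_Morphisms" "HOL-Library.Z2"
begin

text \<open>
  Let \<open>k\<close> be a finite field and \<open>B\<close> a symmetric bilinear form on the space \<open>k\<^sup>V\<close> of functions on the
  vertex set, whose Gram matrix has entry \<open>0\<close> exactly at the adjacent pairs.  On
  \<open>k \<oplus> k\<^sup>V \<oplus> k\<close> put \<open>(a, x, s) (b, y, t) = (ab, ay + bx, at + bs + B(x, y))\<close>.  This is a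
  commutative ring in which \<open>0 \<oplus> k\<^sup>V \<oplus> k\<close> is an ideal with vanishing cube, hence the unique
  maximal ideal.  The basis vectors of \<open>k\<^sup>V\<close> are annihilated by \<open>(0, 0, 1)\<close>, and the product of two
  of them is the corresponding entry of the Gram matrix.
\<close>

section \<open>Local rings\<close>

text \<open>By commutativity, a factor of a unit is a unit, so the nonunits absorb multiplication.
  Closure under addition is all they lack to be an ideal. No proper ideal contains a unit, so this
  ideal contains every proper ideal and is the only maximal one.\<close>

lemma (in cring) local_cringI:
  assumes nontrivial: "\<one> \<noteq> \<zero>"
    and nonunits_add: "\<And>x y. x \<in> carrier R - Units R \<Longrightarrow> y \<in> carrier R - Units R \<Longrightarrow> x \<oplus> y \<notin> Units R"
  shows "local_cring R"
proof -
  let ?J = "carrier R - Units R"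
  have mult: "x \<otimes> a \<in> ?J" if "a \<in> ?J" "x \<in> carrier R" for a x
  proof -
    have "a \<in> Units R" if "x \<otimes> a \<in> Units R"
    proof -
      have "(inv (x \<otimes> a) \<otimes> x) \<otimes> a = \<one>"
        using \<open>a \<in> ?J\<close> \<open>x \<in> carrier R\<close> that by (simp add: m_assoc)
      moreover have "inv (x \<otimes> a) \<otimes> x \<in> carrier R"
        using \<open>x \<in> carrier R\<close> that by simp
      ultimately show ?thesis
        using \<open>a \<in> ?J\<close> m_comm by (auto simp: Units_def)
    qed
    then show ?thesis
      using that by auto
  qed
  have zero: "\<zero> \<in> ?J"
    using nontrivial by (auto simp: Units_def)
  have inv: "\<ominus> a \<in> ?J" if "a \<in> ?J" for a
    \<comment> \<open>Negation is multiplication by minus one, so absorption covers it.\<close>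
    using that mult[of a "\<ominus> \<one>"] l_minus[of \<one> a] by auto
  have "subgroup ?J (add_monoid R)"
    using nonunits_add zero inv by unfold_locales (auto simp: a_inv_def[symmetric] a_assoc)
  then interpret J: ideal ?J R
    using mult m_comm ring_axioms by (intro idealI) auto
  have proper: "I \<subseteq> ?J" if "ideal I R" "I \<noteq> carrier R" for I
  proof
    interpret I: ideal I R by fact
    fix x assume x: "x \<in> I"
    then have "x \<in> carrier R" by (rule I.Icarr)
    moreover have "x \<notin> Units R"
      using I.I_l_closed[OF x, of "inv x"] I.one_imp_carrier that(2) by auto
    ultimately show "x \<in> ?J" by blast
  qed
  have "maximalideal ?J R"
    using proper by unfold_locales auto
  moreover have "M = ?J" if "maximalideal M R" for M
  proof -
    interpret M: maximalideal M R by fact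
    show ?thesis
      using proper[OF M.ideal_axioms] M.I_notcarr M.I_maximal[OF J.ideal_axioms] by auto
  qed
  ultimately show ?thesis
    by unfold_locales blast
qed

section \<open>Transport of a ring along an injection\<close>

lemma image_ring_add:
  assumes "inj_on f (carrier R)" "x \<in> carrier R" "y \<in> carrier R"
  shows "f x \<oplus>\<^bsub>image_ring f R\<^esub> f y = f (x \<oplus>\<^bsub>R\<^esub> y)"
  using ring_iso_memE(3)[OF inj_imp_image_ring_iso[OF assms(1)] assms(2,3)] by simp

lemma image_ring_mult:
  assumes "inj_on f (carrier R)" "x \<in> carrier R" "y \<in> carrier R"
  shows "f x \<otimes>\<^bsub>image_ring f R\<^esub> f y = f (x \<otimes>\<^bsub>R\<^esub> y)"
  using ring_iso_memE(2)[OF inj_imp_image_ring_iso[OF assms(1)] assms(2,3)] by simp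

lemma (in cring) inj_imp_image_ring_is_cring:
  assumes "inj_on f (carrier R)"
  shows "cring (image_ring f R)"
  using ring_iso_imp_img_cring[OF inj_imp_image_ring_iso[OF assms]]
  by (simp add: image_ring_def image_group_def monoid.defs)

lemma (in ring) Units_image_ring:
  assumes "inj_on f (carrier R)"
  shows "Units (image_ring f R) = f ` Units R"
proof -
  have "f (x \<otimes> y) = f \<one> \<longleftrightarrow> x \<otimes> y = \<one>" if "x \<in> carrier R" "y \<in> carrier R" for x y
    using that inj_on_eq_iff[OF assms] by simp
  then show ?thesis
    by (auto simp: Units_def image_ring_carrier image_ring_one image_ring_mult[OF assms]
        intro!: imageI)
qed

section \<open>Realising a graph in a zero-divisor graph\<close>

text \<open>Reduces the embedding to a choice of ring elements with prescribed vanishing products.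
  Only distinct vertices are compared, so the squares of the chosen elements are free.\<close>

lemma digraph_iso_induced_zero_divisor_graph:
  assumes "Digraph.graph G" "cring R" "finite (carrier R)"
    and inj: "inj_on g (verts G)"
    and verts: "g ` verts G \<subseteq> verts (zero_divisor_graph R)"
    and adj: "\<And>u v. u \<in> verts G \<Longrightarrow> v \<in> verts G \<Longrightarrow> u \<noteq> v \<Longrightarrow>
      g u \<otimes>\<^bsub>R\<^esub> g v = \<zero>\<^bsub>R\<^esub> \<longleftrightarrow> (u, v) \<in> arcs_ends G"
  shows "\<exists>H. induced_subgraph H (zero_divisor_graph R) \<and> digraph_iso G H"
proof -
  interpret G: Digraph.graph G by fact
  let ?Z = "zero_divisor_graph R"
  interpret Z: Digraph.graph ?Z
    using assms(2,3) by (rule graph_zero_divisor_graph)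
  define H where "H = ?Z \<restriction> (g ` verts G)"
  \<comment> \<open>Arcs of the zero-divisor graph are themselves pairs of vertices, so an arc of
    \<open>G\<close> goes to the pair of images of its ends. This is injective because
    \<open>G\<close> has no parallel arcs.\<close>
  define f where "f = \<lparr>iso_verts = g, iso_arcs = (\<lambda>e. (g (tail G e), g (head G e))),
    iso_head = snd, iso_tail = fst\<rparr>"
  have "inj_on (\<lambda>e. (g (tail G e), g (head G e))) (arcs G)"
    using inj G.no_multi_arcs by (auto simp: inj_on_def arc_to_ends_def)
  then have "pre_digraph.digraph_isomorphism G f"
    using inj by (simp add: pre_digraph.digraph_isomorphism_def f_def G.wf_digraph)
  moreover have "H = app_iso f G"
  proof -
    have "arcs H = {(g u, g v) |u v. u \<in> verts G \<and> v \<in> verts G \<and> (u, v) \<in> arcs_ends G}"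
    proof -
      have "arcs H = {(x, y). x \<in> g ` verts G \<and> y \<in> g ` verts G \<and> x \<noteq> y \<and> x \<otimes>\<^bsub>R\<^esub> y = \<zero>\<^bsub>R\<^esub>}"
        using verts by (auto simp: H_def zero_divisor_graph_def Let_def)
      also have "\<dots> = {(g u, g v) |u v. u \<in> verts G \<and> v \<in> verts G \<and> (u, v) \<in> arcs_ends G}"
      proof -
        \<comment> \<open>The case \<open>u = v\<close> is included: both sides are then false, the
          right one because \<open>G\<close> has no loops.\<close>
        have "g u \<noteq> g v \<and> g u \<otimes>\<^bsub>R\<^esub> g v = \<zero>\<^bsub>R\<^esub> \<longleftrightarrow> (u, v) \<in> arcs_ends G"
          if "u \<in> verts G" "v \<in> verts G" for u v
          using that adj[of u v] inj_on_eq_iff[OF inj, of u v] G.adj_not_same[of u] by auto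
        then show ?thesis by blast
      qed
      finally show ?thesis .
    qed
    also have "\<dots> = (\<lambda>e. (g (tail G e), g (head G e))) ` arcs G"
      by (fastforce simp: arcs_ends_conv)
    finally show ?thesis
      by (intro pre_digraph.equality) (auto simp: H_def f_def zero_divisor_graph_def Let_def)
  qed
  moreover have "induced_subgraph H ?Z"
    unfolding H_def using verts by (rule Z.induced_induce)
  ultimately show ?thesis
    unfolding digraph_iso_def by blast
qed

section \<open>The ring of a symmetric bilinear form\<close>

definition gram_form :: "'v set \<Rightarrow> ('v \<Rightarrow> 'v \<Rightarrow> 'k::field) \<Rightarrow> ('v \<Rightarrow> 'k) \<Rightarrow> ('v \<Rightarrow> 'k) \<Rightarrow> 'k" where
  "gram_form V c x y = (\<Sum>i\<in>V. \<Sum>j\<in>V. c i j * x i * y j)"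

text \<open>Vectors are total functions vanishing off \<open>V\<close>, so that equal vectors are
  equal functions and finiteness of \<open>V\<close> and of the field makes the carrier
  finite.\<close>

definition form_ring :: "'v set \<Rightarrow> ('v \<Rightarrow> 'v \<Rightarrow> 'k::field) \<Rightarrow> ('k \<times> ('v \<Rightarrow> 'k) \<times> 'k) ring" where
  "form_ring V c =
    \<lparr>carrier = {(a, x, s). \<forall>i. i \<notin> V \<longrightarrow> x i = 0},
     monoid.mult = (\<lambda>(a, x, s) (b, y, t).
       (a * b, (\<lambda>i. a * y i + b * x i), a * t + b * s + gram_form V c x y)),
     one = (1, (\<lambda>_. 0), 0),
     zero = (0, (\<lambda>_. 0), 0),
     add = (\<lambda>(a, x, s) (b, y, t). (a + b, (\<lambda>i. x i + y i), s + t))\<rparr>"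

abbreviation basis_elem :: "'v \<Rightarrow> 'k::field \<times> ('v \<Rightarrow> 'k) \<times> 'k" where
  "basis_elem u \<equiv> (0, (\<lambda>i. of_bool (i = u)), 0)"

lemma gram_form_simps:
  "gram_form V c (\<lambda>_. 0) y = 0"
  "gram_form V c x (\<lambda>_. 0) = 0"
  "gram_form V c (\<lambda>i. x i + x' i) y = gram_form V c x y + gram_form V c x' y"
  "gram_form V c x (\<lambda>i. y i + y' i) = gram_form V c x y + gram_form V c x y'"
  "gram_form V c (\<lambda>i. a * x i) y = a * gram_form V c x y"
  "gram_form V c x (\<lambda>i. a * y i) = a * gram_form V c x y"
  by (simp_all add: gram_form_def algebra_simps sum.distrib sum_distrib_left)

lemma gram_form_commute:
  assumes "\<And>i j. c i j = c j i"
  shows "gram_form V c x y = gram_form V c y x"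
  unfolding gram_form_def by (subst sum.swap) (simp add: assms mult_ac)

lemma gram_form_basis:
  assumes "finite V" "u \<in> V" "v \<in> V"
  shows "gram_form V c (\<lambda>i. of_bool (i = u)) (\<lambda>i. of_bool (i = v)) = c u v"
  using assms by (simp add: gram_form_def of_bool_def if_distrib[of "\<lambda>x. _ * x"] cong: if_cong)

lemma finite_form_ring:
  fixes c :: "'v \<Rightarrow> 'v \<Rightarrow> 'k::field"
  assumes "finite V" "finite (UNIV :: 'k set)"
  shows "finite (carrier (form_ring V c))"
proof -
  have "carrier (form_ring V c) = UNIV \<times> {x. \<forall>i. (i \<in> V \<longrightarrow> x i \<in> UNIV) \<and> (i \<notin> V \<longrightarrow> x i = 0)} \<times> UNIV"
    by (auto simp: form_ring_def)
  also have "finite \<dots>"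
    by (intro finite_cartesian_product finite_set_of_finite_funs assms)
  finally show ?thesis .
qed

text \<open>For associativity, either bracketing of \<open>(a, x, s) (b, y, t) (d, z, r)\<close>
  contributes \<open>a B(y, z) + b B(x, z) + d B(x, y)\<close> to the last component, by
  bilinearity. Symmetry of the form gives commutativity.\<close>

lemma cring_form_ring:
  assumes sym: "\<And>i j. c i j = c j i"
  shows "cring (form_ring V c)"
proof (rule cringI)
  show "abelian_group (form_ring V c)"
  proof (rule abelian_groupI)
    show "\<exists>y\<in>carrier (form_ring V c). y \<oplus>\<^bsub>form_ring V c\<^esub> x = \<zero>\<^bsub>form_ring V c\<^esub>"
      if "x \<in> carrier (form_ring V c)" for x
    proof -
      obtain a y s where "x = (a, y, s)" by (metis prod_cases3)
      then show ?thesis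
        using that by (intro bexI[of _ "(- a, (\<lambda>i. - y i), - s)"]) (auto simp: form_ring_def)
    qed
  qed (auto simp: form_ring_def add_ac)
  show "comm_monoid (form_ring V c)"
    using gram_form_commute[OF sym, of V]
    by (intro comm_monoidI) (auto simp: form_ring_def gram_form_simps algebra_simps)
qed (auto simp: form_ring_def gram_form_simps algebra_simps)

text \<open>The first projection is a ring homomorphism onto the field, so units have nonzero first
  component; conversely an inverse can be written down. As this projection is additive, sums of
  nonunits are nonunits.\<close>

lemma Units_form_ring:
  assumes sym: "\<And>i j. c i j = c j i"
  shows "Units (form_ring V c) = {x \<in> carrier (form_ring V c). fst x \<noteq> 0}"
proof -
  interpret cring "form_ring V c" using sym by (rule cring_form_ring)
  have "\<exists>z\<in>carrier (form_ring V c). (a, y, s) \<otimes>\<^bsub>form_ring V c\<^esub> z = \<one>\<^bsub>form_ring V c\<^esub>"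
    if "(a, y, s) \<in> carrier (form_ring V c)" "a \<noteq> 0" for a y s
  proof
    \<comment> \<open>Found by solving for the components in turn: the second must satisfy
      \<open>a y' + y / a = 0\<close>, and then the third
      \<open>a s' + s / a - B(y, y) / a\<^sup>2 = 0\<close>.\<close>
    let ?z = "(1 / a, (\<lambda>i. - (1 / a\<^sup>2) * y i), (gram_form V c y y / a\<^sup>2 - s / a) / a)"
    show "?z \<in> carrier (form_ring V c)"
      using that by (auto simp: form_ring_def)
    show "(a, y, s) \<otimes>\<^bsub>form_ring V c\<^esub> ?z = \<one>\<^bsub>form_ring V c\<^esub>"
      using that(2) gram_form_simps(6)[of V c y "- (1 / a\<^sup>2)" y] unfolding form_ring_def
      by (simp del: minus_divide_left) (simp add: field_simps power2_eq_square)
  qed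
  then have "x \<in> Units (form_ring V c)" if "x \<in> carrier (form_ring V c)" "fst x \<noteq> 0" for x
    using that m_comm by (cases x) (fastforce simp: Units_def)
  moreover have "fst x \<noteq> 0" if "x \<in> Units (form_ring V c)" for x
    using Units_r_inv[OF that] by (auto simp: form_ring_def split: prod.splits)
  ultimately show ?thesis by auto
qed

section \<open>The non-adjacency form over the field with two elements\<close>

theorem theorem2p9:
  fixes G :: "('a, 'b) pre_digraph"
  assumes "Digraph.graph G"
  shows "\<exists>(R :: nat ring) H. local_cring R \<and> finite (carrier R) \<and>
    induced_subgraph H (zero_divisor_graph R) \<and> digraph_iso G H"
proof -
  interpret G: Digraph.graph G by fact
  define c :: "'a \<Rightarrow> 'a \<Rightarrow> bit" where "c u v = of_bool ((u, v) \<notin> arcs_ends G)" for u v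
  have sym: "c u v = c v u" for u v
    using G.graph_symmetric by (auto simp: c_def)
  define K where "K = form_ring (verts G) c"
  interpret K: cring K
    unfolding K_def using sym by (rule cring_form_ring)
  have "(UNIV :: bit set) = {0, 1}"
    by (auto intro: bit.exhaust)
  then have "finite (UNIV :: bit set)"
    by (metis finite.emptyI finite.insertI)
  then have fin: "finite (carrier K)"
    unfolding K_def by (intro finite_form_ring G.finite_verts)
  \<comment> \<open>The ring sought has natural numbers as elements, so \<open>K\<close> is carried
    over along an injection of its finite carrier.\<close>
  then obtain h :: "_ \<Rightarrow> nat" where h: "inj_on h (carrier K)"
    using finite_imp_inj_to_nat_seg by blast
  have h_eq: "h x = h y \<longleftrightarrow> x = y" if "x \<in> carrier K" "y \<in> carrier K" for x y
    using that inj_on_eq_iff[OF h] by blast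
  define R where "R = image_ring h K"
  note R_simps = image_ring_carrier image_ring_zero image_ring_one
    image_ring_add[OF h] image_ring_mult[OF h]
  interpret R: cring R
    unfolding R_def using h by (rule K.inj_imp_image_ring_is_cring)
  have finR: "finite (carrier R)"
    using fin by (simp add: R_def R_simps)
  have UnitsR: "h x \<in> Units R \<longleftrightarrow> fst x \<noteq> 0" if "x \<in> carrier K" for x
  proof -
    have "Units K = {x \<in> carrier K. fst x \<noteq> 0}"
      unfolding K_def using sym by (rule Units_form_ring)
    moreover have "Units R = h ` Units K"
      unfolding R_def using h by (rule K.Units_image_ring)
    ultimately show ?thesis
      using that inj_on_image_mem_iff[OF h that, of "Units K"] by auto
  qed
  have "local_cring R"
  proof (rule R.local_cringI)
    show "\<one>\<^bsub>R\<^esub> \<noteq> \<zero>\<^bsub>R\<^esub>"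
      using h_eq[of "\<one>\<^bsub>K\<^esub>" "\<zero>\<^bsub>K\<^esub>"] by (simp add: R_def R_simps) (simp add: K_def form_ring_def)
    fix x y assume "x \<in> carrier R - Units R" "y \<in> carrier R - Units R"
    then obtain x' y' where *: "x' \<in> carrier K" "y' \<in> carrier K" "x = h x'" "y = h y'"
      "fst x' = 0" "fst y' = 0"
      using UnitsR by (auto simp: R_def R_simps)
    moreover have "fst (x' \<oplus>\<^bsub>K\<^esub> y') = fst x' + fst y'"
      by (simp add: K_def form_ring_def split: prod.splits)
    ultimately show "x \<oplus>\<^bsub>R\<^esub> y \<notin> Units R"
      using UnitsR[of "x' \<oplus>\<^bsub>K\<^esub> y'"] by (simp add: R_def R_simps)
  qed
  define e :: "'a \<Rightarrow> bit \<times> ('a \<Rightarrow> bit) \<times> bit" where "e u = basis_elem u" for u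
  have e_carrier: "e u \<in> carrier K" if "u \<in> verts G" for u
    using that by (auto simp: e_def K_def form_ring_def)
  have e_eq: "e u = e v \<longleftrightarrow> u = v" for u v
    by (auto simp: e_def fun_eq_iff)
  have e_nonzero: "e u \<noteq> \<zero>\<^bsub>K\<^esub>" for u
    by (auto simp: e_def K_def form_ring_def fun_eq_iff)
  have e_mult: "e u \<otimes>\<^bsub>K\<^esub> e v = (0, (\<lambda>_. 0), c u v)" if "u \<in> verts G" "v \<in> verts G" for u v
    using that by (simp add: e_def K_def form_ring_def gram_form_basis)
  \<comment> \<open>A common nonzero annihilator of all \<open>e u\<close>. It makes each
    \<open>e u\<close> a zero divisor even when \<open>u\<close> is isolated in
    \<open>G\<close>.\<close>
  define t :: "bit \<times> ('a \<Rightarrow> bit) \<times> bit" where "t = (0, (\<lambda>_. 0), 1)"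
  have t: "t \<in> carrier K" "t \<noteq> \<zero>\<^bsub>K\<^esub>" "\<And>u. e u \<otimes>\<^bsub>K\<^esub> t = \<zero>\<^bsub>K\<^esub>"
    by (simp_all add: t_def K_def form_ring_def e_def gram_form_simps)
  have "\<exists>H. induced_subgraph H (zero_divisor_graph R) \<and> digraph_iso G H"
  proof (rule digraph_iso_induced_zero_divisor_graph)
    show "inj_on (h \<circ> e) (verts G)"
      using e_carrier e_eq h_eq by (auto simp: inj_on_def)
    show "(h \<circ> e) ` verts G \<subseteq> verts (zero_divisor_graph R)"
    proof
      fix x assume "x \<in> (h \<circ> e) ` verts G"
      then obtain u where u: "u \<in> verts G" "x = h (e u)" by auto
      have "h (e u) \<noteq> \<zero>\<^bsub>R\<^esub>" "h t \<noteq> \<zero>\<^bsub>R\<^esub>"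
        using u h_eq e_carrier e_nonzero t by (simp_all add: R_def R_simps)
      moreover have "h (e u) \<otimes>\<^bsub>R\<^esub> h t = \<zero>\<^bsub>R\<^esub>"
        using u e_carrier t by (simp add: R_def R_simps)
      moreover have "h (e u) \<in> carrier R" "h t \<in> carrier R"
        using u e_carrier t by (simp_all add: R_def R_simps)
      ultimately show "x \<in> verts (zero_divisor_graph R)"
        using u by (auto simp: zero_divisor_graph_def Let_def)
    qed
    show "(h \<circ> e) u \<otimes>\<^bsub>R\<^esub> (h \<circ> e) v = \<zero>\<^bsub>R\<^esub> \<longleftrightarrow> (u, v) \<in> arcs_ends G"
      if "u \<in> verts G" "v \<in> verts G" "u \<noteq> v" for u v
    proof -
      have "(h \<circ> e) u \<otimes>\<^bsub>R\<^esub> (h \<circ> e) v = \<zero>\<^bsub>R\<^esub> \<longleftrightarrow> e u \<otimes>\<^bsub>K\<^esub> e v = \<zero>\<^bsub>K\<^esub>"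
        using that e_carrier h_eq by (simp add: R_def R_simps)
      also have "\<dots> \<longleftrightarrow> c u v = 0"
        using that by (simp add: e_mult) (simp add: K_def form_ring_def)
      finally show ?thesis by (simp add: c_def)
    qed
  qed (fact assms R.cring_axioms finR)+
  then show ?thesis
    using \<open>local_cring R\<close> finR by blast
qed

end
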